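(* For $n\ge1$ let $P_n(x,z)=\sum_{\sigma\in\mathcal{S}_n}x^{\overrightarrow{des}_E(\sigma)}z^{\chi(\sigma_1\text{ even})}$. Then (1) $P_1(x,z)=1$ and $P_2(x,z)=1+z$; (2) for all $n\ge1$, $P_{2n+1}(x,z)=\Theta_{2n}(P_{2n}(x,z))$; (3) for all $n\ge1$, $P_{2n+2}(x,z)=\Omega_{2n+1}(P_{2n+1}(x,z))$, where $\Theta_{2n}$ is the linear operator on polynomials in $x,z$ (applied to polynomials of degree at most 1 in $z$) sending $z^0x^k\mapsto (n+k+1)z^0x^k+(n-k)z^0x^{k+1}$ and $z^1x^k\mapsto (n+k+1)z^1x^k+z^0x^{k+1}+(n-k-1)z^1x^{k+1}$, and $\Omega_{2n+1}$ is the linear operator sending $z^0x^k\mapsto (n+k+1)z^0x^k+z^1x^k+(n-k)z^0x^{k+1}$ and $z^1x^k\mapsto (n+k+2)z^1x^k+(n-k)z^1x^{k+1}$.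
   Context: $\mathcal{S}_n$ denotes the set of permutations $\sigma=\sigma_1\cdots\sigma_n$ of $\{1,\dots,n\}$. $\overrightarrow{des}_E(\sigma)$ is the number of indices $i\in\{1,\dots,n-1\}$ with $\sigma_i>\sigma_{i+1}$ and $\sigma_{i+1}$ even. $\chi(\sigma_1\text{ even})$ is $1$ if $\sigma_1$ is even and $0$ otherwise. *)

theory Defs
  imports "HOL-Computational_Algebra.Polynomial" "HOL-Combinatorics.Permutations"
begin

text \<open>A polynomial in \<open>x\<close>, \<open>z\<close> over the integers is an \<open>int poly poly\<close>:
  the outer variable is \<open>z\<close>, the inner one is \<open>x\<close>.
  So \<open>zx j k\<close> is the monomial \<open>z^j x^k\<close>.\<close>

definition zx :: "nat \<Rightarrow> nat \<Rightarrow> int poly poly" where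
  "zx j k = monom (monom 1 k) j"

definition scale :: "int \<Rightarrow> int poly poly \<Rightarrow> int poly poly" where
  "scale c p = smult [:c:] p"

definition desE :: "nat \<Rightarrow> (nat \<Rightarrow> nat) \<Rightarrow> nat" where
  "desE n \<sigma> = card {i \<in> {1..n-1}. \<sigma> i > \<sigma> (i + 1) \<and> even (\<sigma> (i + 1))}"

definition P :: "nat \<Rightarrow> int poly poly" where
  "P n = (\<Sum>\<sigma> | \<sigma> permutes {1..n}. zx (of_bool (even (\<sigma> 1))) (desE n \<sigma>))"

text \<open>The linear operator sending \<open>z^j x^k\<close> to \<open>f j k\<close>; that it is this operator is
  proved in the lemmas below.\<close>

definition lin_ext :: "(nat \<Rightarrow> nat \<Rightarrow> int poly poly) \<Rightarrow> int poly poly \<Rightarrow> int poly poly" where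
  "lin_ext f p = (\<Sum>j\<le>degree p. \<Sum>k\<le>degree (coeff p j). scale (coeff (coeff p j) k) (f j k))"

text \<open>\<open>Theta n\<close> is the operator with index \<open>2n\<close> and \<open>Omega n\<close> the one with index \<open>2n+1\<close>.
  They matter only for degree at most 1 in \<open>z\<close>; higher powers of \<open>z\<close> are sent to 0.
  The coefficients are integers, so differences such as \<open>n - k\<close> are not truncated.\<close>

definition Theta :: "nat \<Rightarrow> int poly poly \<Rightarrow> int poly poly" where
  "Theta n = lin_ext (\<lambda>j k.
     if j = 0 then
       scale (int n + int k + 1) (zx 0 k) + scale (int n - int k) (zx 0 (k + 1))
     else if j = 1 then
       scale (int n + int k + 1) (zx 1 k) + zx 0 (k + 1)
         + scale (int n - int k - 1) (zx 1 (k + 1))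
     else 0)"

definition Omega :: "nat \<Rightarrow> int poly poly \<Rightarrow> int poly poly" where
  "Omega n = lin_ext (\<lambda>j k.
     if j = 0 then
       scale (int n + int k + 1) (zx 0 k) + zx 1 k + scale (int n - int k) (zx 0 (k + 1))
     else if j = 1 then
       scale (int n + int k + 2) (zx 1 k) + scale (int n - int k) (zx 1 (k + 1))
     else 0)"

lemma scale_0 [simp]: "scale 0 p = 0"
  by (simp add: scale_def)

lemma scale_add: "scale (a + b) p = scale a p + scale b p"
  by (simp add: scale_def flip: smult_add_left)

lemma scale_scale: "scale a (scale b p) = scale (a * b) p"
  by (simp add: scale_def mult.commute)

lemma scale_sum: "scale a (sum g A) = (\<Sum>i\<in>A. scale a (g i))"
  by (induction A rule: infinite_finite_induct) (simp_all add: scale_def smult_add_right)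

lemma coeff_scale: "coeff (coeff (scale c p) j) k = c * coeff (coeff p j) k"
  by (simp add: scale_def)

lemma lin_ext_bound:
  assumes "degree p \<le> J" "\<And>j. degree (coeff p j) \<le> K"
  shows "lin_ext f p = (\<Sum>j\<le>J. \<Sum>k\<le>K. scale (coeff (coeff p j) k) (f j k))"
proof -
  have "(\<Sum>k\<le>degree (coeff p j). scale (coeff (coeff p j) k) (f j k))
      = (\<Sum>k\<le>K. scale (coeff (coeff p j) k) (f j k))" for j
    using assms(2)[of j] by (intro sum.mono_neutral_left) (auto simp: coeff_eq_0)
  then have "lin_ext f p = (\<Sum>j\<le>degree p. \<Sum>k\<le>K. scale (coeff (coeff p j) k) (f j k))"
    by (simp add: lin_ext_def)
  also have "\<dots> = (\<Sum>j\<le>J. \<Sum>k\<le>K. scale (coeff (coeff p j) k) (f j k))"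
    using assms(1) by (intro sum.mono_neutral_left) (auto simp: coeff_eq_0)
  finally show ?thesis .
qed

lemma degree_coeff_bounded: "\<exists>K. \<forall>j. degree (coeff (p :: int poly poly) j) \<le> K"
proof (intro exI allI)
  fix j
  show "degree (coeff p j) \<le> (\<Sum>i\<le>degree p. degree (coeff p i))"
  proof (cases "j \<le> degree p")
    case True
    then show ?thesis by (intro member_le_sum) auto
  next
    case False
    then show ?thesis by (simp add: coeff_eq_0)
  qed
qed

lemma lin_ext_zx: "lin_ext f (zx j k) = f j k"
proof -
  have "lin_ext f (zx j k) = (\<Sum>i\<le>j. \<Sum>l\<le>k. scale (coeff (coeff (zx j k) i) l) (f i l))"
    by (intro lin_ext_bound) (auto simp: zx_def degree_monom_le)
  also have "\<dots> = (\<Sum>i\<le>j. \<Sum>l\<le>k. if i = j then if l = k then f i l else 0 else 0)"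
    by (intro sum.cong) (auto simp: zx_def scale_def simp flip: one_pCons)
  also have "\<dots> = (\<Sum>i\<le>j. if i = j then f i k else 0)"
    by (intro sum.cong) auto
  also have "\<dots> = f j k"
    by simp
  finally show ?thesis .
qed

lemma lin_ext_add: "lin_ext f (p + q) = lin_ext f p + lin_ext f q"
proof -
  obtain K L where K: "\<And>j. degree (coeff p j) \<le> K" and L: "\<And>j. degree (coeff q j) \<le> L"
    using degree_coeff_bounded by metis
  let ?J = "max (degree p) (degree q)" and ?K = "max K L"
  have p: "degree (coeff p j) \<le> ?K" and q: "degree (coeff q j) \<le> ?K" for j
    using K[of j] L[of j] by auto
  have pq: "degree (coeff (p + q) j) \<le> ?K" for j
    using p q by (simp add: degree_add_le)
  have "degree (p + q) \<le> ?J"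
    by (rule degree_add_le_max)
  then show ?thesis
    using lin_ext_bound[of p ?J ?K f] lin_ext_bound[of q ?J ?K f]
      lin_ext_bound[of "p + q" ?J ?K f] p q pq
    by (simp add: scale_add sum.distrib)
qed

lemma lin_ext_scale: "lin_ext f (scale c p) = scale c (lin_ext f p)"
proof -
  obtain K where K: "\<And>j. degree (coeff p j) \<le> K"
    using degree_coeff_bounded by metis
  have K': "degree (coeff (scale c p) j) \<le> K" for j
    using K[of j] by (simp add: scale_def)
  have J: "degree (scale c p) \<le> degree p"
    by (simp add: scale_def)
  show ?thesis
    using lin_ext_bound[of p "degree p" K f] lin_ext_bound[of "scale c p" "degree p" K f] K K' J
    by (simp add: coeff_scale scale_sum scale_scale)
qed

end

theory Submission
  imports Defs "HOL-Combinatorics.Multiset_Permutations"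
begin

text \<open>Every permutation of \<open>{1..N}\<close> arises exactly once by inserting \<open>N\<close> into a permutation of
  \<open>{1..N-1}\<close>, written as a word. Inserting a letter larger than all others immediately before a
  letter \<open>e\<close> raises the number of descents with even bottom by one if \<open>e\<close> is even and not already
  a descent bottom, and leaves it unchanged otherwise, as does insertion at the end. Counting the
  even letters that are not descent bottoms, with the front position treated separately because it
  affects the first letter, gives the coefficients of both operators.\<close>

section \<open>Permutations as words\<close>

fun even_descents :: "nat list \<Rightarrow> nat" where
  "even_descents (a # b # xs) = of_bool (a > b \<and> even b) + even_descents (b # xs)"
| "even_descents _ = 0"

text \<open>Links \<open>desE\<close> with the recursion on words. The start \<open>m\<close> is
  free so that the induction can strip the first letter; the later use is
  \<open>m = 1\<close>.\<close>

lemma even_descents_map_upt: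
  assumes "m \<le> n"
  shows "even_descents (map f [m..<Suc n]) = card {i \<in> {m..<n}. f i > f (i + 1) \<and> even (f (i + 1))}"
  using assms
proof (induction rule: inc_induct)
  case base
  then show ?case by simp
next
  case (step m)
  let ?Q = "\<lambda>i. f i > f (i + 1) \<and> even (f (i + 1))"
  have upt: "[m..<Suc n] = m # Suc m # [Suc (Suc m)..<Suc n]"
    "[Suc m..<Suc n] = Suc m # [Suc (Suc m)..<Suc n]"
    using step.hyps by (simp_all add: upt_conv_Cons del: upt_Suc)
  have split: "{i \<in> {m..<n}. ?Q i} = (if ?Q m then {m} else {}) \<union> {i \<in> {Suc m..<n}. ?Q i}"
    using step.hyps by (auto simp: Suc_le_eq le_less)
  have "card {i \<in> {m..<n}. ?Q i} = of_bool (?Q m) + card {i \<in> {Suc m..<n}. ?Q i}"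
    unfolding split by (subst card_Un_disjoint) auto
  then show ?case
    using step.IH unfolding upt by simp
qed

lemma bij_betw_permutes_permutations_of_set:
  "bij_betw (\<lambda>\<sigma>. map \<sigma> [1..<Suc n]) {\<sigma>. \<sigma> permutes {1..n}} (permutations_of_set {1..n})"
proof -
  let ?f = "\<lambda>\<sigma>::nat \<Rightarrow> nat. map \<sigma> [1..<Suc n]"
  have inj: "inj_on ?f {\<sigma>. \<sigma> permutes {1..n}}"
  proof (rule inj_onI, clarify)
    fix \<sigma> \<tau> assume *: "\<sigma> permutes {1..n}" "\<tau> permutes {1..n}" "?f \<sigma> = ?f \<tau>"
    have "\<sigma> i = \<tau> i" if "i \<in> {1..n}" for i
      using *(3) that by (auto simp: map_eq_conv simp del: upt_Suc)
    moreover have "\<sigma> i = \<tau> i" if "i \<notin> {1..n}" for i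
      using *(1,2) that by (simp add: permutes_not_in)
    ultimately show "\<sigma> = \<tau>" by blast
  qed
  have sub: "?f ` {\<sigma>. \<sigma> permutes {1..n}} \<subseteq> permutations_of_set {1..n}"
  proof clarify
    fix \<sigma> assume *: "\<sigma> permutes {1..n}"
    have "set (?f \<sigma>) = \<sigma> ` {1..n}"
      by (simp add: atLeastLessThanSuc_atLeastAtMost del: upt_Suc)
    also have "\<dots> = {1..n}"
      using * by (rule permutes_image)
    finally show "?f \<sigma> \<in> permutations_of_set {1..n}"
      using * by (auto simp: permutations_of_set_def distinct_map permutes_inj_on simp del: upt_Suc)
  qed
  \<comment> \<open>Surjectivity comes from counting: the map is injective and both finite sets have
    \<open>n!\<close> elements.\<close>
  have "card (?f ` {\<sigma>. \<sigma> permutes {1..n}}) = card (permutations_of_set {1..n})"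
    using inj by (simp add: card_image card_permutations del: upt_Suc)
  then have "?f ` {\<sigma>. \<sigma> permutes {1..n}} = permutations_of_set {1..n}"
    using sub by (intro card_subset_eq) auto
  with inj show ?thesis by (simp add: bij_betw_def)
qed

lemma P_eq_sum_words:
  assumes "n \<ge> 1"
  shows "P n = (\<Sum>xs\<in>permutations_of_set {1..n}. zx (of_bool (even (hd xs))) (even_descents xs))"
proof -
  have des: "desE n \<sigma> = even_descents (map \<sigma> [1..<Suc n])" for \<sigma>
  proof -
    have "{1..n-1} = {1..<n}" using assms by auto
    then show ?thesis
      using even_descents_map_upt[of 1 n \<sigma>] assms by (simp add: desE_def del: upt_Suc)
  qed
  have hd: "hd (map \<sigma> [1..<Suc n]) = \<sigma> 1" for \<sigma> :: "nat \<Rightarrow> nat"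
    using assms by (simp add: upt_conv_Cons del: upt_Suc)
  show ?thesis
    unfolding P_def des
    using sum.reindex_bij_betw[OF bij_betw_permutes_permutations_of_set[of n],
        of "\<lambda>xs. zx (of_bool (even (hd xs))) (even_descents xs)"]
    by (simp only: hd)
qed

section \<open>Inserting the largest letter\<close>

definition insert_at :: "nat \<Rightarrow> 'a \<Rightarrow> 'a list \<Rightarrow> 'a list" where
  "insert_at i a xs = take i xs @ a # drop i xs"

lemma insert_at_0 [simp]: "insert_at 0 a xs = a # xs"
  and insert_at_Suc_Cons [simp]: "insert_at (Suc i) a (b # xs) = b # insert_at i a xs"
  by (simp_all add: insert_at_def)

text \<open>The inverse deletes \<open>a\<close> and recovers \<open>i\<close> as the length of the
  prefix before \<open>a\<close>; this works because \<open>a\<close> does not occur in the original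
  word.\<close>

lemma bij_betw_insert_at:
  assumes "a \<notin> A" "finite A"
  shows "bij_betw (\<lambda>(xs, i). insert_at i a xs) (permutations_of_set A \<times> {..card A})
    (permutations_of_set (insert a A))"
proof -
  let ?S = "permutations_of_set A \<times> {..card A}" and ?T = "permutations_of_set (insert a A)"
  let ?f = "\<lambda>(xs, i). insert_at i a xs"
  let ?g = "\<lambda>ys. (remove1 a ys, length (takeWhile (\<lambda>y. y \<noteq> a) ys))"
  have f: "?g (?f p) = p \<and> ?f p \<in> ?T" if p: "p \<in> ?S" for p
  proof -
    obtain xs i where p_eq: "p = (xs, i)"
      by force
    have xs: "set xs = A" "distinct xs" "length xs = card A" and i: "i \<le> card A"
      using p p_eq by (auto simp: permutations_of_set_def distinct_card)
    have nin: "a \<notin> set (take i xs)" "a \<notin> set (drop i xs)"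
      using xs assms by (auto dest: in_set_takeD in_set_dropD)
    have "set (insert_at i a xs) = insert a (set (take i xs @ drop i xs))"
      by (auto simp: insert_at_def simp del: append_take_drop_id)
    moreover have "distinct (insert_at i a xs) \<longleftrightarrow> distinct (a # take i xs @ drop i xs)"
      by (auto simp: insert_at_def simp del: append_take_drop_id)
    ultimately have "insert_at i a xs \<in> ?T"
      using xs assms by (simp add: permutations_of_set_def)
    then show ?thesis
      using nin i xs p_eq by (auto simp: insert_at_def remove1_append takeWhile_append min_def)
  qed
  have g: "?f (?g ys) = ys \<and> ?g ys \<in> ?S" if "ys \<in> ?T" for ys
  proof -
    have ys: "set ys = insert a A" "distinct ys"
      using that by (auto simp: permutations_of_set_def)
    obtain us vs where uv: "ys = us @ a # vs" "a \<notin> set us"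
      using ys(1) by (metis insertI1 split_list_first)
    have tw: "length (takeWhile (\<lambda>y. y \<noteq> a) ys) = length us" and rm: "remove1 a ys = us @ vs"
      using uv by (auto simp: takeWhile_append remove1_append)
    have perm: "us @ vs \<in> permutations_of_set A"
      using ys uv assms by (auto simp: permutations_of_set_def)
    then have "card A = length (us @ vs)"
      unfolding permutations_of_set_def by (metis (mono_tags, lifting) distinct_card mem_Collect_eq)
    then show ?thesis
      unfolding tw rm using perm uv(1) by (simp add: insert_at_def)
  qed
  show ?thesis
    by (rule bij_betw_byWitness[where f' = ?g]) (use f g in blast)+
qed

text \<open>Turns \<open>scale\<close> into ring multiplication, so that
  \<open>algebra_simps\<close> can collect coefficients.\<close>

lemma scale_eq_of_int_mult: "scale c p = of_int c * p"
  by (simp add: scale_def of_int_poly)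

text \<open>Every even descent bottom of \<open>a # ys\<close> lies in \<open>ys\<close>, so
  \<open>e - k\<close> counts the even letters of \<open>ys\<close> that are not descent bottoms;
  exactly the gaps before these raise the count. \<open>F\<close> is arbitrary so that the induction
  can absorb the contribution of the first pair.\<close>

lemma sum_insert_at_after_head:
  assumes "\<And>b. b \<in> set (a # ys) \<Longrightarrow> b < N"
  defines "k \<equiv> even_descents (a # ys)" and "e \<equiv> length (filter even ys)"
  shows "(\<Sum>i\<le>length ys. F (even_descents (a # insert_at i N ys)))
    = scale (int (length ys) + 1 - (int e - int k)) (F k) + scale (int e - int k) (F (Suc k))"
  using assms(1) unfolding k_def e_def
proof (induction ys arbitrary: a F)
  case Nil
  then show ?case by (simp add: scale_eq_of_int_mult)
next
  case (Cons b zs)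
  let ?c = "of_bool (a > b \<and> even b) :: nat"
  \<comment> \<open>At position 0 the pair \<open>a\<close>, \<open>b\<close> is broken up: the
    ascent to \<open>N\<close> contributes nothing, and the drop from \<open>N\<close> to
    \<open>b\<close> counts iff \<open>b\<close> is even. At all later positions the pair survives
    and adds the constant \<open>?c\<close>.\<close>
  have "(\<Sum>i\<le>length (b # zs). F (even_descents (a # insert_at i N (b # zs))))
      = F (of_bool (even b) + even_descents (b # zs))
        + (\<Sum>i\<le>length zs. F (?c + even_descents (b # insert_at i N zs)))"
    using Cons.prems[of a] Cons.prems[of b] by (simp add: sum.atMost_Suc_shift del: sum.atMost_Suc)
  also have "(\<Sum>i\<le>length zs. F (?c + even_descents (b # insert_at i N zs)))
      = scale (int (length zs) + 1 - (int (length (filter even zs)) - int (even_descents (b # zs))))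
          (F (?c + even_descents (b # zs)))
        + scale (int (length (filter even zs)) - int (even_descents (b # zs)))
          (F (?c + Suc (even_descents (b # zs))))"
    using Cons.prems by (intro Cons.IH[of b "\<lambda>m. F (?c + m)"]) auto
  finally show ?case
    by (cases "even b"; cases "a > b") (simp_all add: scale_eq_of_int_mult algebra_simps)
qed

lemma length_filter_even_permutation:
  assumes "xs \<in> permutations_of_set {1..m}"
  shows "length (filter even xs) = m div 2"
proof -
  have "length (filter even xs) = card {i \<in> {1..m}. even i}"
    using assms by (simp add: permutations_of_set_def flip: distinct_card)
  also have "{i \<in> {1..m}. even i} = (\<lambda>i. 2 * i) ` {1..m div 2}"
    by (auto elim!: evenE)
  also have "card \<dots> = m div 2"
    by (simp add: card_image inj_on_def)
  finally show ?thesis .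
qed

text \<open>The first summand is insertion at the front: the new head \<open>Suc m\<close> is even
  iff \<open>m\<close> is odd, and the old head becomes a descent bottom, counted iff it is even,
  hence \<open>j + k\<close>. The other \<open>m\<close> gaps keep the head; \<open>d\<close> of
  them, those before an even letter that is not a descent bottom, create a new even descent.\<close>

lemma P_Suc:
  assumes "m \<ge> 1"
  shows "P (Suc m) = (\<Sum>xs\<in>permutations_of_set {1..m}.
    let k = even_descents xs; j = of_bool (even (hd xs)); d = int (m div 2) - int k - int j
    in zx (of_bool (odd m)) (j + k) + scale (int m - d) (zx j k) + scale d (zx j (Suc k)))"
proof -
  let ?w = "\<lambda>xs. zx (of_bool (even (hd xs))) (even_descents xs)"
  have "{1..Suc m} = insert (Suc m) {1..m}"
    by auto
  then have "P (Suc m) = (\<Sum>ys\<in>permutations_of_set (insert (Suc m) {1..m}). ?w ys)"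
    by (simp add: P_eq_sum_words)
  also have "\<dots> = (\<Sum>(xs, i)\<in>permutations_of_set {1..m} \<times> {..m}. ?w (insert_at i (Suc m) xs))"
    using sum.reindex_bij_betw[OF bij_betw_insert_at[of "Suc m" "{1..m}"], of ?w]
    by (simp add: case_prod_unfold)
  also have "\<dots> = (\<Sum>xs\<in>permutations_of_set {1..m}. \<Sum>i\<le>m. ?w (insert_at i (Suc m) xs))"
    by (simp add: sum.cartesian_product)
  also have "\<dots> = (\<Sum>xs\<in>permutations_of_set {1..m}.
    let k = even_descents xs; j = of_bool (even (hd xs)); d = int (m div 2) - int k - int j
    in zx (of_bool (odd m)) (j + k) + scale (int m - d) (zx j k) + scale d (zx j (Suc k)))"
  proof (rule sum.cong[OF refl])
    fix xs assume xs: "xs \<in> permutations_of_set {1..m}"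
    then have set: "set xs = {1..m}" "length xs = m"
      by (auto simp: permutations_of_set_def dest: distinct_card)
    obtain a ys where ay: "xs = a # ys"
      using set assms by (cases xs) auto
    have m: "m = Suc (length ys)"
      using set ay by simp
    have less: "b < Suc m" if "b \<in> set (a # ys)" for b
      using that unfolding ay[symmetric] set(1) by simp
    have evens: "int (length (filter even ys)) = int (m div 2) - of_bool (even a)"
      using length_filter_even_permutation[OF xs] ay by (cases "even a") simp_all
    have "(\<Sum>i\<le>m. ?w (insert_at i (Suc m) xs)) = ?w (Suc m # xs)
        + (\<Sum>i\<le>length ys. zx (of_bool (even a)) (even_descents (a # insert_at i (Suc m) ys)))"
      unfolding ay m by (simp add: sum.atMost_Suc_shift del: sum.atMost_Suc)
    also have "?w (Suc m # xs) = zx (of_bool (odd m)) (of_bool (even a) + even_descents xs)"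
      using less[of a] ay by simp
    also note sum_insert_at_after_head[OF less, where F = "zx (of_bool (even a))"]
    finally show "(\<Sum>i\<le>m. ?w (insert_at i (Suc m) xs)) =
      (let k = even_descents xs; j = of_bool (even (hd xs)); d = int (m div 2) - int k - int j
       in zx (of_bool (odd m)) (j + k) + scale (int m - d) (zx j k) + scale d (zx j (Suc k)))"
      unfolding evens using m ay by (simp add: Let_def algebra_simps)
  qed
  finally show ?thesis .
qed

lemma lin_ext_sum: "lin_ext f (\<Sum>i\<in>A. g i) = (\<Sum>i\<in>A. lin_ext f (g i))"
proof -
  have "lin_ext f 0 = 0"
    by (simp add: lin_ext_def)
  then show ?thesis
    by (induction A rule: infinite_finite_induct) (simp_all add: lin_ext_add)
qed

lemma zx_0_0: "zx 0 0 = 1"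
  by (simp add: zx_def monom_0 one_pCons)

lemma P_1: "P 1 = 1"
  by (simp add: P_eq_sum_words zx_0_0)

lemma P_2: "P 2 = 1 + zx 1 0"
  \<comment> \<open>The only word is \<open>[1]\<close>, for which \<open>d = 0\<close>.\<close>
  using P_Suc[of 1] by (simp add: numeral_2_eq_2 scale_eq_of_int_mult zx_0_0)

section \<open>Comparison with the two operators\<close>

theorem theorem4p1:
  shows "P 1 = 1 \<and> P 2 = 1 + zx 1 0
    \<and> (\<forall>n\<ge>1. P (2 * n + 1) = Theta n (P (2 * n)))
    \<and> (\<forall>n\<ge>1. P (2 * n + 2) = Omega n (P (2 * n + 1)))"
proof (intro conjI allI impI)
  fix n :: nat assume "n \<ge> 1"
  then have m: "2 * n \<ge> 1"
    by simp
  have "P (Suc (2 * n)) = Theta n (P (2 * n))"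
    \<comment> \<open>By linearity both sides become sums over the same words, and they agree word
      by word, with \<open>d = n - k - j\<close>.\<close>
    unfolding P_Suc[OF m] P_eq_sum_words[OF m] Theta_def lin_ext_sum lin_ext_zx
    by (rule sum.cong) (auto simp: Let_def scale_eq_of_int_mult algebra_simps)
  then show "P (2 * n + 1) = Theta n (P (2 * n))"
    by simp
  have m': "Suc (2 * n) \<ge> 1"
    by simp
  have "P (Suc (Suc (2 * n))) = Omega n (P (Suc (2 * n)))"
    \<comment> \<open>Here \<open>(2 * n + 1) div 2 = n\<close>. For \<open>j = 1\<close> the front
      insertion gives \<open>zx 1 (k + 1)\<close>, which raises the coefficient
      \<open>n - k - 1\<close> to the \<open>n - k\<close> of \<open>Omega\<close>.\<close>
    unfolding P_Suc[OF m'] P_eq_sum_words[OF m'] Omega_def lin_ext_sum lin_ext_zx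
    by (rule sum.cong) (auto simp: Let_def scale_eq_of_int_mult algebra_simps)
  then show "P (2 * n + 2) = Omega n (P (2 * n + 1))"
    by simp
qed (fact P_1 P_2)+

end
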